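(* Let $n\ge 1$ and $k$ be integers with $\lfloor n/2\rfloor \le k\le \lfloor (2n-2)/3\rfloor$. Then $\Phi^n_k$ is a median graph.
   Context: A subword of a word is a block of consecutive letters. A binary word (over $\{0,1\}$) of length $n\ge 1$ is Padovan if it starts and ends with $0$, contains no subword $00$, and contains no subword $111$. For $n\ge1$ and $\lfloor n/2\rfloor\le k\le\lfloor(2n-2)/3\rfloor$, the weighted Padovan graph $\Phi^n_k$ is the simple graph whose vertices are all Padovan words of length $n$ with exactly $k$ letters $1$; two vertices are adjacent if one can be obtained from the other by replacing exactly one subword $01$ with $10$. A graph $G$ is a median graph if for every triple of vertices $u,v,w$ of $G$ there exists a unique vertex which lies on a shortest $u,v$-path, on a shortest $u,w$-path, and on a shortest $v,w$-path. *)

theory Defs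
  imports "Graph_Theory.Graph_Theory" "HOL-Library.Sublist" "HOL-Library.Z2"
begin

text \<open>
  Binary words are lists over the two-element type \<^typ>\<open>bit\<close>; a subword is a block of
  consecutive letters, i.e. \<^const>\<open>sublist\<close> (not \<^const>\<open>subseq\<close>).
\<close>

definition padovan_word :: "bit list \<Rightarrow> bool" where
  "padovan_word w \<longleftrightarrow>
     w \<noteq> [] \<and> hd w = 0 \<and> last w = 0 \<and> \<not> sublist [0, 0] w \<and> \<not> sublist [1, 1, 1] w"

definition padovan_words :: "nat \<Rightarrow> nat \<Rightarrow> bit list set" where
  "padovan_words n k = {w. padovan_word w \<and> length w = n \<and> count_list w 1 = k}"

definition swap_01 :: "bit list \<Rightarrow> bit list \<Rightarrow> bool" where
  "swap_01 u v \<longleftrightarrow> (\<exists>xs ys. u = xs @ [0, 1] @ ys \<and> v = xs @ [1, 0] @ ys)"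

text \<open>
  As usual in \<^theory>\<open>Graph_Theory.Graph_Theory\<close>, a simple graph is a symmetric loop-free
  digraph without parallel arcs: an edge is represented by its two orientations.
\<close>

definition padovan_graph :: "nat \<Rightarrow> nat \<Rightarrow> bit list pair_pre_digraph" where
  "padovan_graph n k =
     \<lparr> pverts = padovan_words n k,
       parcs = {(u, v). u \<in> padovan_words n k \<and> v \<in> padovan_words n k \<and>
                        (swap_01 u v \<or> swap_01 v u)} \<rparr>"

context pre_digraph
begin

definition shortest_path :: "'a \<Rightarrow> 'b awalk \<Rightarrow> 'a \<Rightarrow> bool" where
  "shortest_path u p v \<longleftrightarrow> apath u p v \<and> (\<forall>q. apath u q v \<longrightarrow> length p \<le> length q)"

definition on_shortest_path :: "'a \<Rightarrow> 'a \<Rightarrow> 'a \<Rightarrow> bool" where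
  "on_shortest_path u v x \<longleftrightarrow> (\<exists>p. shortest_path u p v \<and> x \<in> set (awalk_verts u p))"

end

text \<open>
  Vertices in different components have no shortest path between them, so the axiom below
  forces a median graph to be connected. The vertices of a triple need not be distinct.
\<close>

locale median_graph = graph +
  assumes ex1_median:
    "\<lbrakk>u \<in> verts G; v \<in> verts G; w \<in> verts G\<rbrakk> \<Longrightarrow>
       \<exists>!x. x \<in> verts G \<and>
            on_shortest_path u v x \<and> on_shortest_path u w x \<and> on_shortest_path v w x"

end

theory Submission
  imports Defs
begin

text \<open>
  Send a word to its height function, which counts the letters 1 in each prefix. Replacing 01
  by 10 raises one height by 1, and the Padovan words are exactly those whose height function
  satisfies a system of difference constraints, so their heights are closed under coordinatewise
  medians. Moreover, whenever the heights of two words differ, one of them can be raised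
  towards the other inside the graph. Hence graph distance is the L1 distance of heights, a
  vertex lies on a shortest path iff it lies coordinatewise between the ends, and the
  coordinatewise median is the unique median vertex.
\<close>

section \<open>Graphs embedded isometrically in integer vectors\<close>

definition median :: "'a::linorder \<Rightarrow> 'a \<Rightarrow> 'a \<Rightarrow> 'a" where
  "median a b c = max (min a b) (min c (max a b))"

lemma abs_between_iff:
  fixes a b x :: "'a::linordered_idom"
  shows "\<bar>a - x\<bar> + \<bar>x - b\<bar> = \<bar>a - b\<bar> \<longleftrightarrow> min a b \<le> x \<and> x \<le> max a b"
  by (cases "a \<le> b") (auto simp: abs_if)

text \<open>The three intervals spanned by pairs of \<open>a\<close>, \<open>b\<close>,
  \<open>c\<close> meet in a single point. This yields existence and uniqueness of the median vertex
  one coordinate at a time.\<close>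

lemma between_all_iff_median:
  fixes a b c x :: "'a::linordered_idom"
  shows "\<bar>a - x\<bar> + \<bar>x - b\<bar> = \<bar>a - b\<bar> \<and> \<bar>a - x\<bar> + \<bar>x - c\<bar> = \<bar>a - c\<bar> \<and>
         \<bar>b - x\<bar> + \<bar>x - c\<bar> = \<bar>b - c\<bar> \<longleftrightarrow> x = median a b c"
  unfolding abs_between_iff median_def
  by (cases "a \<le> b"; cases "b \<le> c"; cases "a \<le> c") auto

lemma median_mono:
  assumes "a \<le> a'" "b \<le> b'" "c \<le> c'"
  shows "median a b c \<le> median a' b' c'"
  unfolding median_def by (intro max.mono min.mono assms)

lemma median_add: "median (a + d) (b + d) (c + d) = median a b c + (d :: 'a::linordered_idom)"
  by (simp add: median_def max_add_distrib_left min_add_distrib_left)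

lemma median_same [simp]: "median a a a = a"
  by (simp add: median_def)

text \<open>
  Only raising is assumed: where \<^term>\<open>u\<close> lies above \<^term>\<open>v\<close>, a path is shortened by raising
  \<^term>\<open>v\<close> instead.
\<close>

locale L1_embedded_graph = graph G for G :: "('a, 'b) pre_digraph" (structure) +
  fixes I :: "'i set" and h :: "'a \<Rightarrow> 'i \<Rightarrow> int"
  assumes finite_I: "finite I"
    and coords_inj: "\<lbrakk>u \<in> verts G; v \<in> verts G; \<And>i. i \<in> I \<Longrightarrow> h u i = h v i\<rbrakk> \<Longrightarrow> u = v"
    and arc_L1: "(u, v) \<in> arcs_ends G \<Longrightarrow> (\<Sum>i\<in>I. \<bar>h u i - h v i\<bar>) = 1"
    and raise: "\<lbrakk>u \<in> verts G; v \<in> verts G; i \<in> I; h u i < h v i\<rbrakk> \<Longrightarrow>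
      \<exists>u'. (u, u') \<in> arcs_ends G \<and> (\<Sum>i\<in>I. \<bar>h u' i - h v i\<bar>) < (\<Sum>i\<in>I. \<bar>h u i - h v i\<bar>)"
    and median_closed: "\<lbrakk>u \<in> verts G; v \<in> verts G; w \<in> verts G\<rbrakk> \<Longrightarrow>
      \<exists>x\<in>verts G. \<forall>i\<in>I. h x i = median (h u i) (h v i) (h w i)"
begin

section \<open>Graph distance as L1 distance\<close>

definition L1 :: "'a \<Rightarrow> 'a \<Rightarrow> int" where
  "L1 u v = (\<Sum>i\<in>I. \<bar>h u i - h v i\<bar>)"

lemma L1_nonneg: "0 \<le> L1 u v"
  by (simp add: L1_def sum_nonneg)

lemma L1_commute: "L1 u v = L1 v u"
  by (simp add: L1_def abs_minus_commute)

lemma L1_triangle: "L1 u v \<le> L1 u x + L1 x v"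
  unfolding L1_def sum.distrib[symmetric] by (rule sum_mono) linarith

text \<open>The triangle inequality holds termwise, so equality of the finite sums forces equality
  in every coordinate.\<close>

lemma L1_between_iff:
  "L1 u x + L1 x v = L1 u v \<longleftrightarrow> (\<forall>i\<in>I. \<bar>h u i - h x i\<bar> + \<bar>h x i - h v i\<bar> = \<bar>h u i - h v i\<bar>)"
  (is "?L \<longleftrightarrow> ?R")
proof
  assume ?L
  then have *: "(\<Sum>i\<in>I. \<bar>h u i - h v i\<bar>) = (\<Sum>i\<in>I. \<bar>h u i - h x i\<bar> + \<bar>h x i - h v i\<bar>)"
    by (simp add: L1_def sum.distrib)
  show ?R
  proof
    fix i assume "i \<in> I"
    with sum_mono_inv[OF * _ this finite_I]
    show "\<bar>h u i - h x i\<bar> + \<bar>h x i - h v i\<bar> = \<bar>h u i - h v i\<bar>" by auto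
  qed
next
  assume ?R
  then show ?L by (simp add: L1_def sum.distrib[symmetric])
qed

lemma L1_le_length_awalk: "awalk u p v \<Longrightarrow> L1 u v \<le> length p"
proof (induction p arbitrary: u)
  case Nil
  then show ?case by (simp add: awalk_Nil_iff L1_def)
next
  case (Cons e p)
  then have "(u, head G e) \<in> arcs_ends G" "L1 (head G e) v \<le> length p"
    by (auto simp: awalk_Cons_iff in_arcs_imp_in_arcs_ends)
  with arc_L1[of u "head G e"] L1_triangle[of u v "head G e"] show ?case
    by (simp add: L1_def)
qed

text \<open>Induction on the distance. Which end can be raised is not known in advance, so walks in
  both directions are carried along: a raise at either end then becomes one and the same
  case.\<close>

lemma awalk_length_L1_both:
  assumes "u \<in> verts G" "v \<in> verts G"
  shows "(\<exists>p. awalk u p v \<and> int (length p) = L1 u v) \<and> (\<exists>p. awalk v p u \<and> int (length p) = L1 v u)"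
  using assms
proof (induction "nat (L1 u v)" arbitrary: u v rule: less_induct)
  case less
  have from_raise: ?case if "a \<in> verts G" "b \<in> verts G" "i \<in> I" "h a i < h b i" "L1 a b = L1 u v"
      "{a, b} = {u, v}" for a b i
  proof -
    from raise[OF that(1-4)] obtain a' where a': "(a, a') \<in> arcs_ends G" and lt: "L1 a' b < L1 a b"
      by (auto simp: L1_def)
    have a'': "(a', a) \<in> arcs_ends G" using arcs_ends_symmetric[OF sym_arcs a'] .
    have "a' \<in> verts G" using a' by (metis adj_in_verts(2))
    \<comment> \<open>One arc changes the distance to \<open>b\<close> by at most 1, and over the
      integers the strict decrease is at least 1.\<close>
    have d: "L1 a b = L1 a' b + 1"
      using lt arc_L1[OF a'] L1_triangle[of a b a'] by (simp add: L1_def)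
    have "nat (L1 a' b) < nat (L1 u v)" using d that(5) L1_nonneg[of a' b] by simp
    from less.hyps[OF this \<open>a' \<in> verts G\<close> that(2)]
    obtain p q where p: "awalk a' p b" "int (length p) = L1 a' b"
      and q: "awalk b q a'" "int (length q) = L1 b a'" by blast
    obtain e where e: "e \<in> arcs G" "tail G e = a" "head G e = a'"
      using a' by (auto simp: arcs_ends_conv)
    obtain f where f: "f \<in> arcs G" "tail G f = a'" "head G f = a"
      using a'' by (auto simp: arcs_ends_conv)
    have "awalk a (e # p) b" "int (length (e # p)) = L1 a b"
      using e p d by (auto simp: awalk_Cons_iff)
    moreover have "awalk b (q @ [f]) a"
      using q f arc_implies_awalk[of f] by (auto intro: awalk_appendI)
    moreover have "int (length (q @ [f])) = L1 b a"
      using q d by (simp add: L1_commute)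
    ultimately have "(\<exists>p. awalk a p b \<and> int (length p) = L1 a b) \<and>
        (\<exists>p. awalk b p a \<and> int (length p) = L1 b a)" by blast
    then show ?thesis
      using that(6) unfolding doubleton_eq_iff by blast
  qed
  show ?case
  proof (cases "u = v")
    case True
    then have "awalk u [] v" "L1 u v = 0"
      using less.prems by (auto simp: awalk_Nil_iff L1_def)
    with True show ?thesis by force
  next
    case False
    then obtain i where "i \<in> I" "h u i \<noteq> h v i"
      using coords_inj less.prems by blast
    then consider "h u i < h v i" | "h v i < h u i" by linarith
    then show ?thesis
    proof cases
      case 1
      from from_raise[OF less.prems \<open>i \<in> I\<close> this refl refl] show ?thesis .
    next
      case 2
      from from_raise[OF less.prems(2,1) \<open>i \<in> I\<close> this L1_commute insert_commute] show ?thesis .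
    qed
  qed
qed

lemma awalk_length_L1:
  assumes "u \<in> verts G" "v \<in> verts G"
  obtains p where "awalk u p v" "int (length p) = L1 u v"
  using awalk_length_L1_both[OF assms] by blast

text \<open>\<open>L1\<close> bounds the length of every walk from below, so a walk attaining it
  cannot repeat a vertex: cutting out the closed part would leave a shorter walk. Hence it is a
  path.\<close>

lemma shortest_path_iff:
  assumes "u \<in> verts G" "v \<in> verts G"
  shows "shortest_path u p v \<longleftrightarrow> awalk u p v \<and> int (length p) = L1 u v"
proof -
  have apathI: "apath u q v" if q: "awalk u q v" "int (length q) = L1 u v" for q
  proof (rule ccontr)
    assume "\<not> apath u q v"
    with q have "\<not> distinct (awalk_verts u q)" by (simp add: apath_def)
    from awalk_not_distinct_decomp[OF q(1) this] obtain a b c x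
      where "q = a @ b @ c" "0 < length b" "awalk u a x" "awalk x c v" by blast
    then have "awalk u (a @ c) v" "length (a @ c) < length q"
      by (simp_all add: awalk_appendI del: awalk_append_iff)
    with q L1_le_length_awalk[of u "a @ c" v] show False by linarith
  qed
  from awalk_length_L1[OF assms] obtain q where q: "awalk u q v" "int (length q) = L1 u v" .
  show ?thesis
  proof
    assume "shortest_path u p v"
    then have "awalk u p v" "length p \<le> length q"
      using apathI[OF q] by (auto simp: shortest_path_def apath_def)
    with q L1_le_length_awalk[of u p v] show "awalk u p v \<and> int (length p) = L1 u v" by simp
  next
    assume p: "awalk u p v \<and> int (length p) = L1 u v"
    have "length p \<le> length q'" if "apath u q' v" for q'
      using p L1_le_length_awalk[OF awalkI_apath[OF that]] by simp
    with p show "shortest_path u p v"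
      using apathI unfolding shortest_path_def by blast
  qed
qed

text \<open>Splitting a shortest path at \<open>x\<close> gives walks of length at least
  \<open>L1 u x\<close> and \<open>L1 x v\<close>; conversely, shortest walks through
  \<open>x\<close> concatenate to one of length \<open>L1 u v\<close>.\<close>

lemma on_shortest_path_iff:
  assumes "u \<in> verts G" "v \<in> verts G" "x \<in> verts G"
  shows "on_shortest_path u v x \<longleftrightarrow> L1 u x + L1 x v = L1 u v"
proof
  assume "on_shortest_path u v x"
  then obtain p where "awalk u p v" "int (length p) = L1 u v" "x \<in> set (awalk_verts u p)"
    using assms unfolding on_shortest_path_def shortest_path_iff[OF assms(1,2)] by blast
  moreover then obtain q r where "p = q @ r" "awalk u q x" "awalk x r v"
    using awalk_decomp by blast
  ultimately show "L1 u x + L1 x v = L1 u v"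
    using L1_triangle[of u v x] L1_le_length_awalk[of u q x] L1_le_length_awalk[of x r v] by simp
next
  assume eq: "L1 u x + L1 x v = L1 u v"
  obtain q where q: "awalk u q x" "int (length q) = L1 u x"
    using awalk_length_L1[OF assms(1,3)] .
  obtain r where r: "awalk x r v" "int (length r) = L1 x v"
    using awalk_length_L1[OF assms(3,2)] .
  have "shortest_path u (q @ r) v"
    using awalk_appendI[OF q(1) r(1)] q(2) r(2) eq shortest_path_iff[OF assms(1,2)] by simp
  moreover have "x \<in> set (awalk_verts u (q @ r))"
    using set_awalk_verts_append[OF q(1) r(1)] hd_in_awalk_verts(1)[OF r(1)] by simp
  ultimately show "on_shortest_path u v x"
    unfolding on_shortest_path_def by blast
qed

lemma median_graph: "median_graph G"
proof unfold_locales
  fix u v w assume uvw: "u \<in> verts G" "v \<in> verts G" "w \<in> verts G"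
  have iff: "on_shortest_path u v x \<and> on_shortest_path u w x \<and> on_shortest_path v w x \<longleftrightarrow>
      (\<forall>i\<in>I. h x i = median (h u i) (h v i) (h w i))" if "x \<in> verts G" for x
    unfolding on_shortest_path_iff[OF uvw(1,2) that] on_shortest_path_iff[OF uvw(1,3) that]
      on_shortest_path_iff[OF uvw(2,3) that] L1_between_iff between_all_iff_median[symmetric] by blast
  from median_closed[OF uvw] obtain m
    where m: "m \<in> verts G" "\<forall>i\<in>I. h m i = median (h u i) (h v i) (h w i)" by blast
  show "\<exists>!x. x \<in> verts G \<and>
      on_shortest_path u v x \<and> on_shortest_path u w x \<and> on_shortest_path v w x"
  proof (rule ex1I[of _ m])
    show "m \<in> verts G \<and>
        on_shortest_path u v m \<and> on_shortest_path u w m \<and> on_shortest_path v w m"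
      using m iff by blast
    show "x = m" if "x \<in> verts G \<and>
        on_shortest_path u v x \<and> on_shortest_path u w x \<and> on_shortest_path v w x" for x
      using that m iff coords_inj[of x m] by metis
  qed
qed

end

section \<open>Height functions of Padovan words\<close>

text \<open>Total on \<open>nat\<close>: past the end of \<open>w\<close> the value stays at the
  number of letters 1, so words can be compared through equality of functions.\<close>

definition height :: "bit list \<Rightarrow> nat \<Rightarrow> int" where
  "height w i = int (count_list (take i w) 1)"

text \<open>Every clause fixes a value or bounds a difference of two values. The clauses express, in
  order: first letter 0; last letter 0, with \<open>k\<close> letters 1 and a constant tail; letters
  in {0,1}; no block 00; no block 111.\<close>

definition padovan_height :: "nat \<Rightarrow> nat \<Rightarrow> (nat \<Rightarrow> int) \<Rightarrow> bool" where
  "padovan_height n k F \<longleftrightarrow>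
     F 0 = 0 \<and> F 1 = 0 \<and> (\<forall>i\<ge>n - 1. F i = int k) \<and>
     (\<forall>i. F i \<le> F (i + 1) \<and> F (i + 1) \<le> F i + 1) \<and>
     (\<forall>i. i + 2 \<le> n \<longrightarrow> F i + 1 \<le> F (i + 2)) \<and>
     (\<forall>i. i + 3 \<le> n \<longrightarrow> F (i + 3) \<le> F i + 2)"

lemma height_0 [simp]: "height w 0 = 0"
  by (simp add: height_def)

lemma height_Suc:
  "height w (Suc i) = height w i + (if i < length w \<and> w ! i = 1 then 1 else 0)"
  by (cases "i < length w") (auto simp: height_def take_Suc_conv_app_nth)

lemma height_ge_length: "length w \<le> i \<Longrightarrow> height w i = int (count_list w 1)"
  by (simp add: height_def)

lemma nth_eq_1_iff_height: "i < length w \<Longrightarrow> w ! i = 1 \<longleftrightarrow> height w (Suc i) = height w i + 1"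
  by (simp add: height_Suc)

lemma nth_eq_0_iff_height: "i < length w \<Longrightarrow> w ! i = 0 \<longleftrightarrow> height w (Suc i) = height w i"
  by (cases "w ! i") (simp_all add: height_Suc)

lemma nth_eq_iff_height:
  assumes "i < length u" "i < length v"
  shows "u ! i = v ! i \<longleftrightarrow> height u (Suc i) - height u i = height v (Suc i) - height v i"
  using assms by (cases "u ! i"; cases "v ! i") (simp_all add: height_Suc)

lemma height_inj:
  assumes "length u = length v" "\<And>i. i \<le> length u \<Longrightarrow> height u i = height v i"
  shows "u = v"
  using assms by (intro nth_equalityI) (auto simp: nth_eq_iff_height)

section \<open>Forbidden blocks as constraints on heights\<close>

lemma sublist_iff_nth:
  "sublist xs ys \<longleftrightarrow> (\<exists>i. i + length xs \<le> length ys \<and> (\<forall>j<length xs. ys ! (i + j) = xs ! j))"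
  (is "_ \<longleftrightarrow> ?R")
proof
  assume "sublist xs ys"
  then obtain ps ss where "ys = ps @ xs @ ss" by (auto simp: sublist_def)
  then show ?R by (intro exI[of _ "length ps"]) (auto simp: nth_append)
next
  assume ?R
  then obtain i where i: "i + length xs \<le> length ys" "\<forall>j<length xs. ys ! (i + j) = xs ! j"
    by blast
  then have "take (length xs) (drop i ys) = xs"
    by (intro nth_equalityI) auto
  then show "sublist xs ys"
    by (metis sublist_drop sublist_take sublist_order.order_trans)
qed

lemma sublist_00_iff: "sublist [0, 0] w \<longleftrightarrow> (\<exists>i. i + 2 \<le> length w \<and> height w (i + 2) = height w i)"
proof -
  have "w ! i = 0 \<and> w ! (i + 1) = 0 \<longleftrightarrow> height w (i + 2) = height w i"
    if "i + 2 \<le> length w" for i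
    using that by (cases "w ! i"; cases "w ! (i + 1)") (simp_all add: height_Suc numeral_2_eq_2)
  then show ?thesis
    by (auto simp: sublist_iff_nth All_less_Suc numeral_2_eq_2)
qed

lemma sublist_111_iff:
  "sublist [1, 1, 1] w \<longleftrightarrow> (\<exists>i. i + 3 \<le> length w \<and> height w (i + 3) = height w i + 3)"
proof -
  have "w ! i = 1 \<and> w ! (i + 1) = 1 \<and> w ! (i + 2) = 1 \<longleftrightarrow> height w (i + 3) = height w i + 3"
    if "i + 3 \<le> length w" for i
    using that
    by (cases "w ! i"; cases "w ! (i + 1)"; cases "w ! (i + 2)")
      (simp_all add: height_Suc numeral_2_eq_2 numeral_3_eq_3)
  then show ?thesis
    by (auto simp: sublist_iff_nth All_less_Suc numeral_2_eq_2 numeral_3_eq_3)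
qed

lemma height_step: "height w i \<le> height w (i + 1) \<and> height w (i + 1) \<le> height w i + 1"
  by (simp add: height_Suc)

text \<open>Heights climb by 0 or 1 per letter, so forbidding the extreme climb over a block (0 over
  two letters, 3 over three) amounts to a linear inequality.\<close>

lemma padovan_height_height_iff:
  assumes "length w = n" "0 < n" "count_list w 1 = k"
  shows "padovan_height n k (height w) \<longleftrightarrow> padovan_word w"
proof -
  have "hd w = 0 \<longleftrightarrow> height w 1 = 0"
    using nth_eq_0_iff_height[of 0 w] assms by (cases w) auto
  moreover have "last w = 0 \<longleftrightarrow> (\<forall>i\<ge>n - 1. height w i = int k)"
  proof -
    have "last w = w ! (n - 1)"
      using assms by (metis last_conv_nth length_greater_0_conv)
    then have "last w = 0 \<longleftrightarrow> height w (n - 1) = int k"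
      using nth_eq_0_iff_height[of "n - 1" w] height_ge_length[of w n] assms by auto
    moreover have "height w i = int k" if "i \<ge> n - 1" "i \<noteq> n - 1" for i
      using that assms by (simp add: height_ge_length)
    ultimately show ?thesis by (metis order_refl)
  qed
  moreover have "height w (i + 2) \<noteq> height w i \<longleftrightarrow> height w i + 1 \<le> height w (i + 2)" for i
    using height_step[of w i] height_step[of w "i + 1"] by auto
  moreover have "height w (i + 3) \<noteq> height w i + 3 \<longleftrightarrow> height w (i + 3) \<le> height w i + 2" for i
    using height_step[of w i] height_step[of w "i + 1"] height_step[of w "i + 2"]
    by (auto simp: numeral_3_eq_3 numeral_2_eq_2)
  ultimately show ?thesis
    using assms height_step
    unfolding padovan_height_def padovan_word_def sublist_00_iff sublist_111_iff by auto
qed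

lemma padovan_height_height:
  assumes "w \<in> padovan_words n k"
  shows "padovan_height n k (height w)"
  using assms padovan_height_height_iff[of w n k]
  by (auto simp: padovan_words_def padovan_word_def)

text \<open>Medians and raises are constructed as functions; this turns them back into vertices by
  reading the letters off the increments.\<close>

lemma padovan_height_surj:
  assumes F: "padovan_height n k F" and n: "0 < n"
  obtains w where "w \<in> padovan_words n k" "height w = F"
proof -
  define w :: "bit list" where "w = map (\<lambda>i. if F (i + 1) = F i then 0 else 1) [0..<n]"
  have len: "length w = n" by (simp add: w_def)
  have step: "F (Suc i) = F i \<or> F (Suc i) = F i + 1" for i
    proof -
    have "F i \<le> F (i + 1)" "F (i + 1) \<le> F i + 1" using F by (simp_all add: padovan_height_def)
    then show ?thesis by auto
  qed
  have le: "height w i = F i" if "i \<le> n" for i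
    using that
  proof (induction i)
    case 0
    then show ?case using F by (simp add: padovan_height_def)
  next
    case (Suc i)
    then show ?case using step[of i] by (auto simp: height_Suc len w_def)
  qed
  have "count_list w 1 = k"
    using le[of n] F len height_ge_length[of w n] by (simp add: padovan_height_def)
  moreover have "height w = F"
  proof
    fix i show "height w i = F i"
      using le[of i] le[of n] F height_ge_length[of w i] height_ge_length[of w n] len
      by (cases "i \<le> n") (simp_all add: padovan_height_def)
  qed
  ultimately show thesis
    using that[of w] padovan_height_height_iff[of w n k] F n len by (simp add: padovan_words_def)
qed

section \<open>Swaps, medians and raises of heights\<close>

lemma height_append: "height (xs @ ys) i = height xs i + height ys (i - length xs)"
  by (simp add: height_def)

lemma height_Cons:
  "height (x # xs) i = (if i = 0 then 0 else (if x = 1 then 1 else 0) + height xs (i - 1))"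
  by (auto simp: height_def take_Cons')

lemma swap_01_iff_height:
  assumes len: "length u = length v"
  shows "swap_01 u v \<longleftrightarrow> (\<exists>j. height v = (height u)(j := height u j + 1))"
proof
  assume "swap_01 u v"
  then obtain xs ys where "u = xs @ [0, 1] @ ys" "v = xs @ [1, 0] @ ys"
    by (auto simp: swap_01_def)
  then have "height v = (height u)(Suc (length xs) := height u (Suc (length xs)) + 1)"
    by (auto simp: height_append height_Cons fun_eq_iff)
  then show "\<exists>j. height v = (height u)(j := height u j + 1)" ..
next
  assume "\<exists>j. height v = (height u)(j := height u j + 1)"
  then obtain j where j: "height v = (height u)(j := height u j + 1)" ..
  have "j \<noteq> 0" using j by (metis fun_upd_same height_0 add_0 zero_neq_one)
  then obtain i where i: "j = Suc i" using not0_implies_Suc by blast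
  \<comment> \<open>Past the last letter both heights are constant, so they cannot differ at
    \<open>j\<close> and agree at \<open>Suc j\<close>.\<close>
  have lt: "j < length u"
  proof (rule ccontr)
    assume "\<not> j < length u"
    then have "height u (Suc j) = height u j" "height v (Suc j) = height v j"
      using len by (simp_all add: height_Suc)
    with j show False by simp
  qed
  have at: "height v (Suc i) = height u (Suc i) + 1" "height v i = height u i"
    "height v (Suc (Suc i)) = height u (Suc (Suc i))"
    using j i by auto
  \<comment> \<open>The heights agree on both sides of \<open>j\<close> and differ by 1 at
    \<open>j\<close>; with increments 0 or 1 this forces 01 in \<open>u\<close> and 10 in
    \<open>v\<close>.\<close>
  have digits: "u ! i = 0" "v ! i = 1" "u ! Suc i = 1" "v ! Suc i = 0"
    using at lt i len height_step[of u i] height_step[of v i]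
      height_step[of u "Suc i"] height_step[of v "Suc i"]
    by (auto simp: nth_eq_0_iff_height nth_eq_1_iff_height)
  have other: "u ! l = v ! l" if "l < length u" "l \<noteq> i" "l \<noteq> Suc i" for l
    using that j i len by (subst nth_eq_iff_height) auto
  have "take i u = take i v" "drop (i + 2) u = drop (i + 2) v"
    using other lt i len by (auto intro!: nth_equalityI)
  moreover have "u = take i u @ [u ! i, u ! Suc i] @ drop (i + 2) u"
    "v = take i v @ [v ! i, v ! Suc i] @ drop (i + 2) v"
    using lt i len by (simp_all add: Cons_nth_drop_Suc)
  ultimately show "swap_01 u v"
    unfolding swap_01_def digits by metis
qed

text \<open>The median is monotone and commutes with adding a constant, so it preserves each
  difference constraint.\<close>

lemma padovan_height_median:
  assumes "padovan_height n k f" "padovan_height n k g" "padovan_height n k h"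
  shows "padovan_height n k (\<lambda>i. median (f i) (g i) (h i))"
  using assms unfolding padovan_height_def median_add[symmetric]
  by (auto intro!: median_mono)

text \<open>
  Raising \<^term>\<open>f\<close> at \<^term>\<open>j\<close> can only violate a constraint that is tight at \<^term>\<open>j\<close>, and a
  constraint tight between \<^term>\<open>j\<close> and \<^term>\<open>i\<close> forces \<^prop>\<open>f i < g i\<close>. All such \<^term>\<open>i\<close> have
  \<^prop>\<open>5 * f i - 3 * int i < 5 * f j - 3 * int j\<close> because the slope 3/5 lies strictly
  between the extreme densities 1/2 and 2/3 of the letter 1; so a minimizer \<^term>\<open>j\<close> works.
\<close>

lemma padovan_height_raise:
  assumes f: "padovan_height n k f" and g: "padovan_height n k g" and "f i < g i"
  obtains j where "f j < g j" "padovan_height n k (f(j := f j + 1))"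
proof -
  define S where "S = {i. f i < g i}"
  have eq: "f 0 = g 0" "f 1 = g 1" "\<And>i. i \<ge> n - 1 \<Longrightarrow> f i = g i"
    using f g by (simp_all add: padovan_height_def)
  have "S \<subseteq> {..<n - 1}"
    using eq(3) by (force simp: S_def not_less[symmetric])
  then have "finite S" by (rule finite_subset) simp
  moreover have "S \<noteq> {}" using assms(3) by (auto simp: S_def)
  ultimately obtain j where "is_arg_min (\<lambda>i. 5 * f i - 3 * int i) (\<lambda>i. i \<in> S) j"
    using ex_is_arg_min_if_finite by blast
  then have j: "f j < g j" and min: "\<And>i. f i < g i \<Longrightarrow> 5 * f j - 3 * int j \<le> 5 * f i - 3 * int i"
    by (auto simp: is_arg_min_linorder S_def)
  have bounds: "j \<noteq> 0" "j \<noteq> 1" "j < n - 1"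
    using j eq by (metis less_irrefl, metis less_irrefl, metis less_irrefl not_less)
  have F: "f i \<le> f (i + 1)" "f (i + 1) \<le> f i + 1" "i + 2 \<le> n \<Longrightarrow> f i + 1 \<le> f (i + 2)"
    "i + 3 \<le> n \<Longrightarrow> f (i + 3) \<le> f i + 2" for i
    using f by (simp_all add: padovan_height_def)
  have G: "g i \<le> g (i + 1)" "g (i + 1) \<le> g i + 1" "i + 2 \<le> n \<Longrightarrow> g i + 1 \<le> g (i + 2)"
    "i + 3 \<le> n \<Longrightarrow> g (i + 3) \<le> g i + 2" for i
    using g by (simp_all add: padovan_height_def)
  \<comment> \<open>If one of the next four inequalities failed, the constraint on \<open>f\<close>
    would be tight, and the same constraint on \<open>g\<close> would put \<open>j + 1\<close>,
    \<open>j - 1\<close>, \<open>j + 2\<close> or \<open>j - 3\<close> into \<open>S\<close>. The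
    minimized quantity would change by -3, -2, -1 or -1 respectively, contradicting
    minimality.\<close>
  have 1: "f j + 1 \<le> f (j + 1)"
    using F(1)[of j] G(1)[of j] min[of "j + 1"] j by fastforce
  have 2: "f (i + 1) + 1 \<le> f i + 1" if "j = i + 1" for i
    using F(2)[of i] G(2)[of i] min[of i] j that by fastforce
  have 3: "f j + 2 \<le> f (j + 2)" if "j + 2 \<le> n"
    using F(3)[of j] G(3)[of j] min[of "j + 2"] j that by fastforce
  have 4: "f (i + 3) + 1 \<le> f i + 2" if "j = i + 3" "i + 3 \<le> n" for i
    using F(4)[of i] G(4)[of i] min[of i] j that by fastforce
  have "padovan_height n k (f(j := f j + 1))"
    unfolding padovan_height_def
  proof (intro conjI allI impI)
    show "(f(j := f j + 1)) i = int k" if "n - 1 \<le> i" for i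
      using that bounds f by (simp add: padovan_height_def)
    show "(f(j := f j + 1)) i \<le> (f(j := f j + 1)) (i + 1)" for i
      using F(1)[of i] 1 by auto
    show "(f(j := f j + 1)) (i + 1) \<le> (f(j := f j + 1)) i + 1" for i
      using F(2)[of i] 2[of i] by auto
    show "(f(j := f j + 1)) i + 1 \<le> (f(j := f j + 1)) (i + 2)" if "i + 2 \<le> n" for i
      using F(3)[of i] 3 that by auto
    show "(f(j := f j + 1)) (i + 3) \<le> (f(j := f j + 1)) i + 2" if "i + 3 \<le> n" for i
      using F(4)[of i] 4[of i] that by auto
  qed (use bounds f in \<open>auto simp: padovan_height_def\<close>)
  with j show thesis by (rule that)
qed

text \<open>All vertices have height \<open>k\<close> from position \<open>n\<close> on, so the
  changed position is one of the coordinates \<open>{..<n}\<close> over which the distance is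
  summed.\<close>

lemma padovan_arc_iff_height:
  assumes "u \<in> padovan_words n k" "v \<in> padovan_words n k"
  shows "(u, v) \<in> parcs (padovan_graph n k) \<longleftrightarrow>
    (\<exists>j<n. height v = (height u)(j := height u j + 1) \<or> height u = (height v)(j := height v j + 1))"
proof -
  have "j < n" if "height y = (height x)(j := height x j + 1)"
    "x \<in> padovan_words n k" "y \<in> padovan_words n k" for x y j
  proof (rule ccontr)
    assume "\<not> j < n"
    then have "height x j = int k" "height y j = int k"
      using that(2,3) by (simp_all add: padovan_words_def height_ge_length)
    with that(1) show False by simp
  qed
  moreover have "length u = length v" using assms by (simp add: padovan_words_def)
  ultimately show ?thesis
    using assms by (auto simp: padovan_graph_def swap_01_iff_height)
qed

section \<open>The Padovan graph as an embedded graph\<close>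

lemma finite_padovan_words: "finite (padovan_words n k)"
proof (rule finite_subset)
  show "padovan_words n k \<subseteq> {w. set w \<subseteq> UNIV \<and> length w = n}"
    by (auto simp: padovan_words_def)
  have "(UNIV :: bit set) = {0, 1}" by (auto intro: bit.exhaust)
  then have "finite (UNIV :: bit set)" by (metis finite.emptyI finite.insertI)
  then show "finite {w :: bit list. set w \<subseteq> UNIV \<and> length w = n}"
    by (rule finite_lists_length_eq)
qed

lemma graph_padovan_graph: "graph (with_proj (padovan_graph n k))"
proof -
  have sub: "parcs (padovan_graph n k) \<subseteq> padovan_words n k \<times> padovan_words n k"
    by (auto simp: padovan_graph_def)
  have "pair_graph (padovan_graph n k)"
  proof unfold_locales
    show "finite (pverts (padovan_graph n k))"
      by (simp add: padovan_graph_def finite_padovan_words)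
    show "finite (parcs (padovan_graph n k))"
      using finite_subset[OF sub] finite_padovan_words by blast
    show "fst e \<noteq> snd e" if "e \<in> parcs (padovan_graph n k)" for e
      using that by (auto simp: padovan_graph_def swap_01_def)
    show "symmetric (with_proj (padovan_graph n k))"
      by (auto simp: symmetric_def padovan_graph_def intro: symI)
  qed (auto simp: padovan_graph_def)
  then show ?thesis by (rule pair_graph.pair_graphD_graph)
qed

lemma L1_embedded_padovan_graph:
  assumes n: "0 < n"
  shows "L1_embedded_graph (with_proj (padovan_graph n k)) {..<n} height"
proof -
  have verts: "pverts (padovan_graph n k) = padovan_words n k"
    by (simp add: padovan_graph_def)
  show ?thesis
    unfolding L1_embedded_graph_def L1_embedded_graph_axioms_def with_proj_simps verts
  proof (intro conjI allI impI graph_padovan_graph)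
    show "finite {..<n}" by simp
  next
    fix u v assume "u \<in> padovan_words n k" "v \<in> padovan_words n k"
      and "\<forall>i. i \<in> {..<n} \<longrightarrow> height u i = height v i"
    then show "u = v"
      by (intro height_inj)
        (auto simp: padovan_words_def height_ge_length le_less)
  next
    fix u v assume arc: "(u, v) \<in> parcs (padovan_graph n k)"
    then have "u \<in> padovan_words n k" "v \<in> padovan_words n k"
      by (auto simp: padovan_graph_def)
    with arc obtain j where "j < n"
      "height v = (height u)(j := height u j + 1) \<or> height u = (height v)(j := height v j + 1)"
      by (auto simp: padovan_arc_iff_height)
    moreover then have "(\<Sum>i<n. \<bar>height u i - height v i\<bar>) = (\<Sum>i<n. if i = j then 1 else 0)"
      by (intro sum.cong) auto
    ultimately show "(\<Sum>i<n. \<bar>height u i - height v i\<bar>) = 1"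
      by simp
  next
    fix u v i assume u: "u \<in> padovan_words n k" and v: "v \<in> padovan_words n k"
      and "height u i < height v i"
    then obtain j where j: "height u j < height v j"
      "padovan_height n k ((height u)(j := height u j + 1))"
      using padovan_height_raise padovan_height_height by metis
    have "j < n"
      using j(1) u v by (metis (mono_tags, lifting) height_ge_length less_irrefl mem_Collect_eq
          not_less padovan_words_def)
    obtain u' where u': "u' \<in> padovan_words n k" "height u' = (height u)(j := height u j + 1)"
      using padovan_height_surj[OF j(2) n] .
    have "(u, u') \<in> parcs (padovan_graph n k)"
      using u u' \<open>j < n\<close> by (auto simp: padovan_arc_iff_height)
    \<comment> \<open>By integrality a raise by 1 at \<open>j\<close> does not overshoot
      \<open>height v j\<close>, so the term at \<open>j\<close> drops and all others are
      unchanged.\<close>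
    moreover have "(\<Sum>i<n. \<bar>height u' i - height v i\<bar>) < (\<Sum>i<n. \<bar>height u i - height v i\<bar>)"
      using u'(2) j(1) \<open>j < n\<close> by (intro sum_strict_mono_ex1) (auto intro!: bexI[of _ j])
    ultimately show "\<exists>u'. (u, u') \<in> parcs (padovan_graph n k) \<and>
        (\<Sum>i<n. \<bar>height u' i - height v i\<bar>) < (\<Sum>i<n. \<bar>height u i - height v i\<bar>)" by blast
  next
    fix u v w
    assume "u \<in> padovan_words n k" "v \<in> padovan_words n k" "w \<in> padovan_words n k"
    then have "padovan_height n k (\<lambda>i. median (height u i) (height v i) (height w i))"
      by (intro padovan_height_median padovan_height_height)
    from padovan_height_surj[OF this n]
    show "\<exists>x\<in>padovan_words n k. \<forall>i\<in>{..<n}.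
        height x i = median (height u i) (height v i) (height w i)" by metis
  qed
qed

theorem theorem4p2:
  fixes n k :: nat
  assumes "n \<ge> 1"
    and "n div 2 \<le> k"
    and "k \<le> (2 * n - 2) div 3"
  shows "median_graph (with_proj (padovan_graph n k))"
  using assms(1) by (intro L1_embedded_graph.median_graph[OF L1_embedded_padovan_graph]) simp

end
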